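(* Let $A\in\mathbb{R}^{n\times n}$ be entrywise nonnegative with $A\mathbf{1}>\mathbf{0}$ (entrywise), let $\alpha>0$ be such that $\alpha\rho(A)<1$, and let $\widehat{\boldsymbol{\mu}}\in\mathbb{R}^n$ satisfy $\widehat{\boldsymbol{\mu}}\ge\mathbf{1}$ (entrywise). Then the set of matrices $\Delta\in\mathbb{S}(A)$ such that $$(I-\alpha(A+\Delta))\widehat{\boldsymbol{\mu}}-\mathbf{1}=\mathbf{0}\quad\text{and}\quad A+\Delta\ge 0$$ is non-empty. Moreover, for any such matrix $\Delta$ we have $\alpha\rho(A+\Delta)<1$.
   Context: Here $\mathbf{1}$ denotes the all-ones vector in $\mathbb{R}^n$, $\rho(\cdot)$ is the spectral radius, and inequalities between vectors or matrices are entrywise. For a matrix $A\in\mathbb{R}^{n\times n}$, $\mathbb{S}(A)$ is the set of matrices $B\in\mathbb{R}^{n\times n}$ such that $[B]_{i,j}\ne 0$ implies $[A]_{i,j}\neq 0$ (i.e. the nonzero pattern of $B$ is contained in that of $A$). *)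

theory Defs
  imports "Jordan_Normal_Form.Spectral_Radius"
begin

definition ones_vec :: "nat \<Rightarrow> real vec" where
  "ones_vec n = vec n (\<lambda>_. 1)"

(* The library's spectral radius is defined for complex matrices only; the eigenvalues
   of a real matrix are taken over the complex numbers. *)
definition real_spectral_radius :: "real mat \<Rightarrow> real" where
  "real_spectral_radius A = spectral_radius (map_mat complex_of_real A)"

definition pattern_mats :: "real mat \<Rightarrow> real mat set" where
  "pattern_mats A = {B \<in> carrier_mat (dim_row A) (dim_col A).
     \<forall>i < dim_row A. \<forall>j < dim_col A. B $$ (i, j) \<noteq> 0 \<longrightarrow> A $$ (i, j) \<noteq> 0}"

end

(* Existence: rescale each row of A so that the i-th row equation holds; the rescaling factor is
   well defined because row i of A has positive sum and \<mu> \<ge> 1.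
   Bound: for B = A + \<Delta> the equation says \<alpha> B \<mu> = \<mu> - 1 < \<mu> with \<mu> > 0, so the
   Collatz--Wielandt bound gives \<alpha> \<rho>(B) < 1. *)
theory Submission
  imports Defs
begin

text \<open>Weighted maximum argument: at an index \<open>i\<close> maximizing |v_i| / \<mu>_i for
  an eigenvector \<open>v\<close>, the triangle inequality in row \<open>i\<close> of the eigenvalue
  equation compares |z| directly with (B \<mu>)_i / \<mu>_i, which is below
  \<open>t\<close>.\<close>

lemma eigenvalue_norm_less_of_mult_less:
  fixes B :: "real mat" and \<mu> :: "nat \<Rightarrow> real"
  assumes B: "B \<in> carrier_mat n n"
    and nonneg: "\<And>i j. i < n \<Longrightarrow> j < n \<Longrightarrow> 0 \<le> B $$ (i, j)"
    and pos: "\<And>i. i < n \<Longrightarrow> 0 < \<mu> i"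
    and less: "\<And>i. i < n \<Longrightarrow> (\<Sum>j<n. B $$ (i, j) * \<mu> j) < t * \<mu> i"
    and ev: "eigenvalue (map_mat complex_of_real B) z"
  shows "norm z < t"
proof -
  let ?C = "map_mat complex_of_real B"
  obtain v where v: "v \<in> carrier_vec n" "v \<noteq> 0\<^sub>v n" "?C *\<^sub>v v = z \<cdot>\<^sub>v v"
    using ev B unfolding eigenvalue_def eigenvector_def by auto
  obtain k where k: "k < n" "v $ k \<noteq> 0"
    using v(1,2) by (metis carrier_vecD eq_vecI index_zero_vec)
  define q where "q i = norm (v $ i) / \<mu> i" for i
  have "\<exists>i\<in>{..<n}. \<forall>j\<in>{..<n}. q j \<le> q i"
  proof -
    have "Max (q ` {..<n}) \<in> q ` {..<n}" using k by (intro Max_in) auto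
    then obtain i where "i < n" "Max (q ` {..<n}) = q i" by auto
    then show ?thesis by (metis Max_ge finite_imageI finite_lessThan imageI lessThan_iff)
  qed
  then obtain i where i: "i < n" and max: "\<And>j. j < n \<Longrightarrow> q j \<le> q i" by auto
  \<comment> \<open>A nonzero entry of the eigenvector makes the maximum \<open>q i\<close>
    positive, so multiplying by it keeps the final inequality strict and it can be cancelled at the
    end.\<close>
  have "0 < q k" using k pos by (simp add: q_def)
  then have qi: "0 < q i" using max[OF k(1)] by linarith
  have norm_le: "norm (v $ j) \<le> q i * \<mu> j" if "j < n" for j
    using max[OF that] pos[OF that] by (simp add: q_def[of j] pos_divide_le_eq)
  have norm_i: "norm (v $ i) = q i * \<mu> i" using pos[OF i] by (simp add: q_def)
  have "z * v $ i = (\<Sum>j<n. complex_of_real (B $$ (i, j)) * v $ j)"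
  proof -
    have "z * v $ i = (?C *\<^sub>v v) $ i" using v i by simp
    also have "\<dots> = (\<Sum>j<n. complex_of_real (B $$ (i, j)) * v $ j)"
      using B v(1) i by (simp add: scalar_prod_def atLeast0LessThan)
    finally show ?thesis .
  qed
  then have "norm z * (q i * \<mu> i) = norm (\<Sum>j<n. complex_of_real (B $$ (i, j)) * v $ j)"
    by (metis norm_i norm_mult)
  also have "\<dots> \<le> (\<Sum>j<n. B $$ (i, j) * norm (v $ j))"
    by (rule order_trans[OF norm_sum]) (use nonneg i in \<open>auto simp: norm_mult intro!: sum_mono\<close>)
  also have "\<dots> \<le> (\<Sum>j<n. B $$ (i, j) * (q i * \<mu> j))"
    using nonneg i norm_le by (intro sum_mono mult_left_mono) auto
  also have "\<dots> = q i * (\<Sum>j<n. B $$ (i, j) * \<mu> j)"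
    by (simp add: sum_distrib_left mult_ac)
  also have "\<dots> < q i * (t * \<mu> i)" using less[OF i] qi by simp
  finally have "norm z * (q i * \<mu> i) < t * (q i * \<mu> i)" by (simp add: mult_ac)
  then show ?thesis using qi pos[OF i] by simp
qed

text \<open>For \<open>0 < n\<close> the spectrum is nonempty and finite, so the spectral radius is
  the modulus of an actual eigenvalue and inherits the strict bound.\<close>

lemma real_spectral_radius_less_of_mult_less:
  fixes B :: "real mat" and \<mu> :: "nat \<Rightarrow> real"
  assumes B: "B \<in> carrier_mat n n" and "0 < n"
    and "\<And>i j. i < n \<Longrightarrow> j < n \<Longrightarrow> 0 \<le> B $$ (i, j)"
    and "\<And>i. i < n \<Longrightarrow> 0 < \<mu> i"
    and "\<And>i. i < n \<Longrightarrow> (\<Sum>j<n. B $$ (i, j) * \<mu> j) < t * \<mu> i"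
  shows "real_spectral_radius B < t"
proof -
  have "map_mat complex_of_real B \<in> carrier_mat n n" using B by simp
  from spectral_radius_mem_max(1)[OF this \<open>0 < n\<close>]
  obtain z where "eigenvalue (map_mat complex_of_real B) z" "real_spectral_radius B = norm z"
    by (auto simp: real_spectral_radius_def spectrum_def)
  then show ?thesis using eigenvalue_norm_less_of_mult_less[OF B assms(3-5)] by simp
qed

text \<open>The rowwise form serves both halves of the theorem: existence verifies it for a
  constructed matrix, and the spectral bound reads B \<mu> off from it.\<close>

lemma resolvent_mult_eq_ones_iff:
  fixes B :: "real mat"
  assumes "B \<in> carrier_mat n n" and "\<mu> \<in> carrier_vec n"
  shows "(1\<^sub>m n - \<alpha> \<cdot>\<^sub>m B) *\<^sub>v \<mu> - ones_vec n = 0\<^sub>v n \<longleftrightarrow>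
    (\<forall>i<n. \<alpha> * (\<Sum>j<n. B $$ (i, j) * \<mu> $ j) = \<mu> $ i - 1)"
proof -
  have "((1\<^sub>m n - \<alpha> \<cdot>\<^sub>m B) *\<^sub>v \<mu> - ones_vec n) $ i =
      \<mu> $ i - \<alpha> * (\<Sum>j<n. B $$ (i, j) * \<mu> $ j) - 1" if "i < n" for i
  proof -
    have "((1\<^sub>m n - \<alpha> \<cdot>\<^sub>m B) *\<^sub>v \<mu>) $ i =
        (\<Sum>j<n. ((if i = j then 1 else 0) - \<alpha> * B $$ (i, j)) * \<mu> $ j)"
      using assms that by (simp add: scalar_prod_def atLeast0LessThan)
    also have "\<dots> = (\<Sum>j<n. (if i = j then \<mu> $ j else 0) - \<alpha> * (B $$ (i, j) * \<mu> $ j))"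
      by (intro sum.cong) (auto simp: algebra_simps)
    also have "\<dots> = \<mu> $ i - \<alpha> * (\<Sum>j<n. B $$ (i, j) * \<mu> $ j)"
      using that by (simp add: sum_subtractf sum_distrib_left)
    finally show ?thesis using that by (simp add: ones_vec_def)
  qed
  then show ?thesis using assms by (auto simp: vec_eq_iff ones_vec_def)
qed

(* The order on vectors and matrices is entrywise for \<le>, but < is its strict part
   (\<le> and not \<ge>), so entrywise strict positivity is written out. *)
theorem proposition3p1:
  fixes A :: "real mat" and \<alpha> :: real and \<mu> :: "real vec" and n :: nat
  assumes "A \<in> carrier_mat n n" and "0\<^sub>m n n \<le> A"
    and "\<forall>i < n. (A *\<^sub>v ones_vec n) $ i > 0"
    and "\<alpha> > 0" and "\<alpha> * real_spectral_radius A < 1"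
    and "\<mu> \<in> carrier_vec n" and "ones_vec n \<le> \<mu>"
  shows "{\<Delta> \<in> pattern_mats A.
            (1\<^sub>m n - \<alpha> \<cdot>\<^sub>m (A + \<Delta>)) *\<^sub>v \<mu> - ones_vec n = 0\<^sub>v n \<and> 0\<^sub>m n n \<le> A + \<Delta>} \<noteq> {} \<and>
         (\<forall>\<Delta> \<in> pattern_mats A.
            (1\<^sub>m n - \<alpha> \<cdot>\<^sub>m (A + \<Delta>)) *\<^sub>v \<mu> - ones_vec n = 0\<^sub>v n \<and> 0\<^sub>m n n \<le> A + \<Delta>
            \<longrightarrow> \<alpha> * real_spectral_radius (A + \<Delta>) < 1)"
proof (intro conjI ballI impI)
  have A: "A \<in> carrier_mat n n" and \<mu>: "\<mu> \<in> carrier_vec n" by fact+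
  have A_nonneg: "0 \<le> A $$ (i, j)" if "i < n" "j < n" for i j
    using assms(1,2) that by (auto simp: less_eq_mat_def)
  have \<mu>_ge: "1 \<le> \<mu> $ i" if "i < n" for i
    using assms(6,7) that by (auto simp: less_eq_vec_def ones_vec_def)
  {
    define s where "s i = (\<Sum>j<n. A $$ (i, j) * \<mu> $ j)" for i
    \<comment> \<open>Since \<mu> \<ge> 1 and A is nonnegative, \<open>s i\<close> is at least the
      positive sum of row \<open>i\<close>; hence the divisor in \<open>c\<close> is
      positive.\<close>
    have s_pos: "0 < s i" if i: "i < n" for i
    proof -
      have "0 < (\<Sum>j<n. A $$ (i, j))"
        using assms(1,3) i by (auto simp: ones_vec_def scalar_prod_def atLeast0LessThan)
      also have "\<dots> \<le> s i" unfolding s_def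
        using mult_left_mono[OF \<mu>_ge A_nonneg[OF i]] by (intro sum_mono) simp
      finally show ?thesis .
    qed
    \<comment> \<open>The factor solves \<alpha> * c_i * s_i = \<mu>_i - 1, and \<mu> \<ge> 1 makes
      it nonnegative. It vanishes exactly when \<mu>_i = 1, which wipes out the row.\<close>
    define c where "c i = (\<mu> $ i - 1) / (\<alpha> * s i)" for i
    have c_nonneg: "0 \<le> c i" if "i < n" for i
      using \<mu>_ge[OF that] s_pos[OF that] \<open>\<alpha> > 0\<close> by (simp add: c_def)
    \<comment> \<open>Scaling rows creates no new nonzero entries, so \<open>B - A\<close> stays
      within the pattern of \<open>A\<close> and serves as the witness.\<close>
    define B where "B = mat n n (\<lambda>(i, j). A $$ (i, j) * c i)"
    have B: "B \<in> carrier_mat n n" by (simp add: B_def)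
    have sum: "A + (B - A) = B" using A B by (intro eq_matI) auto
    have "\<alpha> * (\<Sum>j<n. B $$ (i, j) * \<mu> $ j) = \<mu> $ i - 1" if i: "i < n" for i
    proof -
      have "(\<Sum>j<n. B $$ (i, j) * \<mu> $ j) = s i * c i"
        unfolding s_def sum_distrib_right using i by (intro sum.cong) (simp_all add: B_def)
      then show ?thesis using s_pos[OF i] \<open>\<alpha> > 0\<close> by (simp add: c_def)
    qed
    then have eq: "(1\<^sub>m n - \<alpha> \<cdot>\<^sub>m B) *\<^sub>v \<mu> - ones_vec n = 0\<^sub>v n"
      using resolvent_mult_eq_ones_iff[OF B \<mu>] by blast
    have "0\<^sub>m n n \<le> B"
      using A_nonneg c_nonneg by (simp add: less_eq_mat_def B_def)
    moreover have "B - A \<in> pattern_mats A"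
      using A by (auto simp: pattern_mats_def B_def)
    ultimately show "{\<Delta> \<in> pattern_mats A. (1\<^sub>m n - \<alpha> \<cdot>\<^sub>m (A + \<Delta>)) *\<^sub>v \<mu> - ones_vec n = 0\<^sub>v n \<and>
        0\<^sub>m n n \<le> A + \<Delta>} \<noteq> {}"
      using eq by (subst ex_in_conv[symmetric], intro exI[of _ "B - A"]) (simp add: sum)
  }
  fix \<Delta>
  assume "\<Delta> \<in> pattern_mats A"
    and h: "(1\<^sub>m n - \<alpha> \<cdot>\<^sub>m (A + \<Delta>)) *\<^sub>v \<mu> - ones_vec n = 0\<^sub>v n \<and> 0\<^sub>m n n \<le> A + \<Delta>"
  then have B: "A + \<Delta> \<in> carrier_mat n n" using A by (auto simp: pattern_mats_def)
  show "\<alpha> * real_spectral_radius (A + \<Delta>) < 1"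
  proof (cases "n = 0")
    \<comment> \<open>An empty matrix has no eigenvalues, so its spectral radius is the unspecified
      \<open>Max {}\<close>; the bound is then the hypothesis on \<open>A\<close>, as all empty matrices coincide.\<close>
    case True
    then have "A + \<Delta> = A" using A B by (intro eq_matI) auto
    then show ?thesis using assms(5) by simp
  next
    case False
    have "real_spectral_radius (A + \<Delta>) < 1 / \<alpha>"
    \<comment> \<open>The vector \<mu> itself supplies the positive weights, with \<open>t\<close>
      equal to 1 / \<alpha>.\<close>
    proof (rule real_spectral_radius_less_of_mult_less[OF B, where \<mu> = "\<lambda>i. \<mu> $ i"])
      show "0 < n" using False by simp
      show "0 \<le> (A + \<Delta>) $$ (i, j)" if "i < n" "j < n" for i j
        using h B that by (auto simp: less_eq_mat_def)
      show "0 < \<mu> $ i" if "i < n" for i using \<mu>_ge[OF that] by simp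
      show "(\<Sum>j<n. (A + \<Delta>) $$ (i, j) * \<mu> $ j) < 1 / \<alpha> * \<mu> $ i" if "i < n" for i
      proof -
        have "\<alpha> * (\<Sum>j<n. (A + \<Delta>) $$ (i, j) * \<mu> $ j) = \<mu> $ i - 1"
          using h resolvent_mult_eq_ones_iff[OF B \<mu>] that by blast
        \<comment> \<open>The all-ones term of the equation is the slack that makes this strict in
          every row.\<close>
        then have "\<alpha> * (\<Sum>j<n. (A + \<Delta>) $$ (i, j) * \<mu> $ j) < \<mu> $ i" by linarith
        then show ?thesis using \<open>\<alpha> > 0\<close> by (simp add: pos_less_divide_eq mult.commute)
      qed
    qed
    then show ?thesis using \<open>\<alpha> > 0\<close> by (simp add: pos_less_divide_eq mult.commute)
  qed
qed

end
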